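(* Let $S=M_2(\mathbb{R}^{+})$ be the semiring of $2\times 2$ matrices with non-negative real entries. Every left $S$-semimodule is $S$-$i$-injective.
   Context: $\mathbb{R}^{+}$ is the semiring of non-negative real numbers with usual addition and multiplication; $M_2(\mathbb{R}^+)$ has matrix addition and multiplication. A left $S$-semimodule is a commutative monoid with a unital action of $S$ satisfying the usual module axioms, including $0m=0$ and $s0=0$ (no additive inverses required); $S$ is a left semimodule over itself by left multiplication. A subsemimodule $L\leq_S M$ is subtractive if whenever $m\in M$ and $m+l=l'$ for some $l,l'\in L$, then $m\in L$. A normal monomorphism is an injective $S$-linear map $f:L\to M$ whose image $f(L)$ is a subtractive subsemimodule of $M$. A left $S$-semimodule $I$ is $S$-$i$-injective if for every normal monomorphism $f:L\to S$ of left $S$-semimodules and every $S$-linear map $g:L\to I$ there is an $S$-linear map $h:S\to I$ with $h\circ f=g$. *)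

theory Defs
  imports "HOL-Analysis.Finite_Cartesian_Product" "HOL-Algebra.Module"
begin

text \<open>
  Semimodules reuse the record type of \<^theory>\<open>HOL-Algebra.Module\<close>; as there, the fields
  \<open>mult\<close> and \<open>one\<close> of the record are not used. The scalars form a semiring with one that is
  not assumed to be commutative, and addition in the semimodule need not have inverses.
\<close>

locale left_semimodule = S?: Ring.semiring S + M?: abelian_monoid M
  for S (structure) and M (structure) +
  assumes smult_closed [simp, intro]:
      "\<lbrakk>a \<in> carrier S; x \<in> carrier M\<rbrakk> \<Longrightarrow> a \<odot>\<^bsub>M\<^esub> x \<in> carrier M"
    and smult_l_distr:
      "\<lbrakk>a \<in> carrier S; b \<in> carrier S; x \<in> carrier M\<rbrakk> \<Longrightarrow>
        (a \<oplus> b) \<odot>\<^bsub>M\<^esub> x = a \<odot>\<^bsub>M\<^esub> x \<oplus>\<^bsub>M\<^esub> b \<odot>\<^bsub>M\<^esub> x"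
    and smult_r_distr:
      "\<lbrakk>a \<in> carrier S; x \<in> carrier M; y \<in> carrier M\<rbrakk> \<Longrightarrow>
        a \<odot>\<^bsub>M\<^esub> (x \<oplus>\<^bsub>M\<^esub> y) = a \<odot>\<^bsub>M\<^esub> x \<oplus>\<^bsub>M\<^esub> a \<odot>\<^bsub>M\<^esub> y"
    and smult_assoc:
      "\<lbrakk>a \<in> carrier S; b \<in> carrier S; x \<in> carrier M\<rbrakk> \<Longrightarrow>
        (a \<otimes> b) \<odot>\<^bsub>M\<^esub> x = a \<odot>\<^bsub>M\<^esub> (b \<odot>\<^bsub>M\<^esub> x)"
    and smult_one [simp]: "x \<in> carrier M \<Longrightarrow> \<one> \<odot>\<^bsub>M\<^esub> x = x"
    and smult_l_null [simp]: "x \<in> carrier M \<Longrightarrow> \<zero> \<odot>\<^bsub>M\<^esub> x = \<zero>\<^bsub>M\<^esub>"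
    and smult_r_null [simp]: "a \<in> carrier S \<Longrightarrow> a \<odot>\<^bsub>M\<^esub> \<zero>\<^bsub>M\<^esub> = \<zero>\<^bsub>M\<^esub>"

definition regular_semimodule :: "('s, 'c) ring_scheme \<Rightarrow> ('s, 's) module" where
  "regular_semimodule S =
    \<lparr>carrier = carrier S, mult = (\<otimes>\<^bsub>S\<^esub>), one = \<one>\<^bsub>S\<^esub>, zero = \<zero>\<^bsub>S\<^esub>, add = (\<oplus>\<^bsub>S\<^esub>),
     smult = (\<otimes>\<^bsub>S\<^esub>)\<rparr>"

definition subsemimodule ::
    "('s, 'c) ring_scheme \<Rightarrow> 'm set \<Rightarrow> ('s, 'm, 'd) module_scheme \<Rightarrow> bool" where
  "subsemimodule S L M \<longleftrightarrow>
    L \<subseteq> carrier M \<and> \<zero>\<^bsub>M\<^esub> \<in> L \<and>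
    (\<forall>x\<in>L. \<forall>y\<in>L. x \<oplus>\<^bsub>M\<^esub> y \<in> L) \<and>
    (\<forall>a\<in>carrier S. \<forall>x\<in>L. a \<odot>\<^bsub>M\<^esub> x \<in> L)"

definition subtractive_subsemimodule ::
    "('s, 'c) ring_scheme \<Rightarrow> 'm set \<Rightarrow> ('s, 'm, 'd) module_scheme \<Rightarrow> bool" where
  "subtractive_subsemimodule S L M \<longleftrightarrow>
    subsemimodule S L M \<and>
    (\<forall>m\<in>carrier M. \<forall>l\<in>L. \<forall>l'\<in>L. m \<oplus>\<^bsub>M\<^esub> l = l' \<longrightarrow> m \<in> L)"

text \<open>
  Linear maps between semimodules; preservation of zero follows from \<open>0m = 0\<close>.
  Only the values of \<open>f\<close> on the carrier of \<open>L\<close> matter.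
\<close>

definition semimodule_hom ::
    "('s, 'c) ring_scheme \<Rightarrow> ('s, 'l, 'd) module_scheme \<Rightarrow> ('s, 'm, 'e) module_scheme \<Rightarrow>
      ('l \<Rightarrow> 'm) set" where
  "semimodule_hom S L M =
    {f \<in> carrier L \<rightarrow> carrier M.
      (\<forall>x\<in>carrier L. \<forall>y\<in>carrier L. f (x \<oplus>\<^bsub>L\<^esub> y) = f x \<oplus>\<^bsub>M\<^esub> f y) \<and>
      (\<forall>a\<in>carrier S. \<forall>x\<in>carrier L. f (a \<odot>\<^bsub>L\<^esub> x) = a \<odot>\<^bsub>M\<^esub> f x)}"

definition normal_mono ::
    "('s, 'c) ring_scheme \<Rightarrow> ('s, 'l, 'd) module_scheme \<Rightarrow> ('s, 'm, 'e) module_scheme \<Rightarrow>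
      ('l \<Rightarrow> 'm) \<Rightarrow> bool" where
  "normal_mono S L M f \<longleftrightarrow>
    f \<in> semimodule_hom S L M \<and> inj_on f (carrier L) \<and>
    subtractive_subsemimodule S (f ` carrier L) M"

text \<open>
  \<open>S\<close>-\<open>i\<close>-injectivity of \<open>I\<close>. A definition in HOL cannot quantify over the type of the elements
  of the semimodule \<open>L\<close>, so this type is passed as a parameter; a theorem in which it is a
  type variable speaks about all semimodules \<open>L\<close>.
\<close>

definition S_i_injective ::
    "'l itself \<Rightarrow> ('s, 'c) ring_scheme \<Rightarrow> ('s, 'm, 'd) module_scheme \<Rightarrow> bool" where
  "S_i_injective (_ :: 'l itself) S I \<longleftrightarrow>
    left_semimodule S I \<and>
    (\<forall>(L :: ('s, 'l) module) f g.
      left_semimodule S L \<longrightarrow>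
      normal_mono S L (regular_semimodule S) f \<longrightarrow>
      g \<in> semimodule_hom S L I \<longrightarrow>
      (\<exists>h \<in> semimodule_hom S (regular_semimodule S) I. \<forall>x\<in>carrier L. (h \<circ> f) x = g x))"

definition nonneg_mat2 :: "(real^2^2) ring" where
  "nonneg_mat2 =
    \<lparr>carrier = {A. \<forall>i j. 0 \<le> A $ i $ j}, mult = (**), one = mat 1, zero = 0, add = (+)\<rparr>"

lemma semiring_nonneg_mat2: "Ring.semiring nonneg_mat2"
proof (intro Ring.semiring.intro Ring.semiring_axioms.intro)
  show "abelian_monoid nonneg_mat2"
    by (rule abelian_monoidI) (auto simp: nonneg_mat2_def algebra_simps)
  have "0 \<le> (A ** B) $ i $ j"
    if "\<forall>i j. 0 \<le> A $ i $ j" "\<forall>i j. 0 \<le> B $ i $ j" for A B :: "real^2^2" and i j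
    using that by (auto simp: matrix_matrix_mult_def intro!: sum_nonneg)
  moreover have "0 \<le> (mat 1 :: real^2^2) $ i $ j" for i j
    by (simp add: mat_def)
  ultimately show "Group.monoid nonneg_mat2"
    by (intro monoidI) (auto simp: nonneg_mat2_def matrix_mul_assoc)
qed (auto simp: nonneg_mat2_def matrix_add_ldistrib matrix_matrix_mult_def vec_eq_iff
    sum.distrib distrib_left distrib_right)

lemma (in Ring.semiring) left_semimodule_regular: "left_semimodule R (regular_semimodule R)"
proof -
  have "abelian_monoid (regular_semimodule R)"
    by (rule abelian_monoidI) (auto simp: regular_semimodule_def semiring_simprules)
  then show ?thesis
    by (intro left_semimodule.intro left_semimodule_axioms.intro semiring_axioms)
      (auto simp: regular_semimodule_def semiring_simprules)
qed

end

theory Submission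
  imports Defs "HOL-Analysis.Cartesian_Space"
begin

text \<open>
  Every subtractive left ideal \<open>L\<close> of \<open>M\<^sub>2(\<real>\<^sup>+)\<close> contains a right identity \<open>e\<close> of itself, so
  \<open>x \<mapsto> g (x f\<inverse>(e))\<close> extends \<open>g\<close>. To find \<open>e\<close>, note that \<open>L\<close> consists of the matrices
  with rows in a subtractive convex cone \<open>C\<close> of the quadrant. If \<open>C\<close> contains two linearly
  independent vectors, then Cramer's rule, with negative terms moved to the other side, puts both
  unit vectors into \<open>C\<close> and \<open>e = 1\<close> works. Otherwise \<open>C\<close> is zero or the ray of some \<open>(p, q)\<close>,
  and \<open>e\<close> has a single nonzero row, \<open>(1, q/p)\<close> on top if \<open>p > 0\<close> and \<open>(0, 1)\<close> at the bottom
  if \<open>p = 0\<close>.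
\<close>

lemma S_i_injective_if_right_identities:
  fixes S :: "('s, 'c) ring_scheme" and I :: "('s, 'm, 'd) module_scheme"
  assumes I: "left_semimodule S I"
    and right_identity: "\<And>J. subtractive_subsemimodule S J (regular_semimodule S) \<Longrightarrow>
      \<exists>e\<in>J. \<forall>a\<in>J. a \<otimes>\<^bsub>S\<^esub> e = a"
  shows "S_i_injective TYPE('l) S I"
  unfolding S_i_injective_def
proof (intro conjI allI impI I)
  fix L :: "('s, 'l) module" and f g
  assume L: "left_semimodule S L" and f: "normal_mono S L (regular_semimodule S) f"
    and g: "g \<in> semimodule_hom S L I"
  interpret L: left_semimodule S L by (rule L)
  have f_smult: "f (a \<odot>\<^bsub>L\<^esub> x) = a \<otimes>\<^bsub>S\<^esub> f x" if "a \<in> carrier S" "x \<in> carrier L" for a x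
    using f that by (auto simp: normal_mono_def semimodule_hom_def regular_semimodule_def)
  have f_closed: "f x \<in> carrier S" if "x \<in> carrier L" for x
    using f that by (auto simp: normal_mono_def semimodule_hom_def regular_semimodule_def)
  have inj: "inj_on f (carrier L)" and
    sub: "subtractive_subsemimodule S (f ` carrier L) (regular_semimodule S)"
    using f by (auto simp: normal_mono_def)
  obtain e where e: "e \<in> carrier L" and fe: "\<And>x. x \<in> carrier L \<Longrightarrow> f x \<otimes>\<^bsub>S\<^esub> f e = f x"
    using right_identity[OF sub] by auto
  \<comment> \<open>Here \<open>e\<close> lies in \<open>L\<close>; the right identity of the image
    of \<open>f\<close> is \<open>f e\<close>.\<close>
  define h where "h x = g (x \<odot>\<^bsub>L\<^esub> e)" for x
  have "h \<in> semimodule_hom S (regular_semimodule S) I"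
    using g e by (auto simp: h_def semimodule_hom_def regular_semimodule_def Pi_iff
        L.smult_l_distr L.smult_assoc intro: left_semimodule.smult_closed[OF I])
  \<comment> \<open>Both sides have the same image under the injective \<open>f\<close>, since
    \<open>f (f x e) = f x f e = f x\<close>.\<close>
  moreover have "f x \<odot>\<^bsub>L\<^esub> e = x" if "x \<in> carrier L" for x
    using that e by (intro inj_onD[OF inj]) (simp_all add: f_smult fe f_closed)
  ultimately show "\<exists>h\<in>semimodule_hom S (regular_semimodule S) I. \<forall>x\<in>carrier L. (h \<circ> f) x = g x"
    by (intro bexI[of _ h]) (simp_all add: h_def)
qed

text \<open>Explicit entries turn matrix identities into real arithmetic for the simplifier.\<close>

definition mat2 :: "real \<Rightarrow> real \<Rightarrow> real \<Rightarrow> real \<Rightarrow> real^2^2" where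
  "mat2 a b c d = vector [vector [a, b], vector [c, d]]"

lemma mat2_eta: "mat2 (A $ 1 $ 1) (A $ 1 $ 2) (A $ 2 $ 1) (A $ 2 $ 2) = A"
  by (simp add: mat2_def vec_eq_iff forall_2)

lemma mat2_cases: obtains a b c d where "A = mat2 a b c d"
  by (metis mat2_eta)

lemma mat2_add: "mat2 a b c d + mat2 a' b' c' d' = mat2 (a + a') (b + b') (c + c') (d + d')"
  by (simp add: mat2_def vec_eq_iff forall_2)

lemma mat2_mult:
  "mat2 a b c d ** mat2 a' b' c' d' =
    mat2 (a * a' + b * c') (a * b' + b * d') (c * a' + d * c') (c * b' + d * d')"
  by (simp add: mat2_def vec_eq_iff forall_2 matrix_matrix_mult_def sum_2)

lemma mat2_eq_iff: "mat2 a b c d = mat2 a' b' c' d' \<longleftrightarrow> a = a' \<and> b = b' \<and> c = c' \<and> d = d'"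
  by (auto simp: mat2_def vec_eq_iff forall_2)

lemma mat2_in_carrier:
  "mat2 a b c d \<in> carrier nonneg_mat2 \<longleftrightarrow> 0 \<le> a \<and> 0 \<le> b \<and> 0 \<le> c \<and> 0 \<le> d"
  by (auto simp: mat2_def nonneg_mat2_def forall_2)

lemma zero_eq_mat2: "(0 :: real^2^2) = mat2 0 0 0 0"
  by (simp add: mat2_def vec_eq_iff forall_2)

lemma subtractive_left_ideal_right_identity:
  assumes "subtractive_subsemimodule nonneg_mat2 J (regular_semimodule nonneg_mat2)"
  shows "\<exists>e\<in>J. \<forall>a\<in>J. a \<otimes>\<^bsub>nonneg_mat2\<^esub> e = a"
proof -
  have J_carrier: "J \<subseteq> carrier nonneg_mat2"
    and J_zero: "0 \<in> J"
    and J_add: "\<And>A B. A \<in> J \<Longrightarrow> B \<in> J \<Longrightarrow> A + B \<in> J"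
    and J_mult: "\<And>X A. X \<in> carrier nonneg_mat2 \<Longrightarrow> A \<in> J \<Longrightarrow> X ** A \<in> J"
    and J_subtractive:
      "\<And>A B. A \<in> carrier nonneg_mat2 \<Longrightarrow> B \<in> J \<Longrightarrow> A + B \<in> J \<Longrightarrow> A \<in> J"
    using assms
    by (simp_all add: subtractive_subsemimodule_def subsemimodule_def regular_semimodule_def
        nonneg_mat2_def) blast
  define C where "C p q \<longleftrightarrow> mat2 p q 0 0 \<in> J" for p q
  \<comment> \<open>Left multiplication by matrix units moves a row to the top or to the bottom and
    clears the other row.\<close>
  have J_iff: "mat2 a b c d \<in> J \<longleftrightarrow> C a b \<and> C c d" for a b c d
  proof
    assume A: "mat2 a b c d \<in> J"
    have "mat2 1 0 0 0 ** mat2 a b c d \<in> J" "mat2 0 1 0 0 ** mat2 a b c d \<in> J"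
      by (intro J_mult A; simp add: mat2_in_carrier)+
    then show "C a b \<and> C c d" by (simp add: C_def mat2_mult)
  next
    assume "C a b \<and> C c d"
    then have "mat2 a b 0 0 + mat2 0 0 1 0 ** mat2 c d 0 0 \<in> J"
      by (intro J_add J_mult) (simp_all add: C_def mat2_in_carrier)
    then show "mat2 a b c d \<in> J" by (simp add: mat2_mult mat2_add)
  qed
  have C_zero: "C 0 0"
    using J_zero by (simp add: C_def zero_eq_mat2)
  have C_nonneg: "0 \<le> p" "0 \<le> q" if "C p q" for p q
    using that J_carrier mat2_in_carrier[of p q 0 0] by (auto simp: C_def)
  have C_scale: "C (t * p) (t * q)" if "0 \<le> t" "C p q" for t p q
    using J_mult[of "mat2 t 0 0 0" "mat2 p q 0 0"] that
    by (simp add: C_def mat2_mult mat2_in_carrier)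
  have C_subtractive: "C p q" if "C r s" "C (p + r) (q + s)" "0 \<le> p" "0 \<le> q" for p q r s
    using J_subtractive[of "mat2 p q 0 0" "mat2 r s 0 0"] that
    by (simp add: C_def mat2_add mat2_in_carrier)
  have mult_eq: "A \<otimes>\<^bsub>nonneg_mat2\<^esub> B = A ** B" for A B
    by (simp add: nonneg_mat2_def)
  show ?thesis
  \<comment> \<open>A positive determinant suffices as the test for independence, because swapping
    the two vectors changes its sign.\<close>
  proof (cases "\<exists>p q r s. C p q \<and> C r s \<and> q * r < p * s")
    case True
    then obtain p q r s where C: "C p q" "C r s" and det: "q * r < p * s" by blast
    define d where "d = p * s - q * r"
    have d: "0 < d" using det by (simp add: d_def)
    \<comment> \<open>Cancel \<open>q (r, s)\<close> in
      \<open>s (p, q) = (d, 0) + q (r, s)\<close>.\<close>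
    have "C d 0"
      using C_scale[OF C_nonneg(2)[OF C(1)] C(2)] C_scale[OF C_nonneg(2)[OF C(2)] C(1)]
        C_subtractive[of "q * r" "q * s" d 0] d
      by (simp add: d_def mult.commute)
    \<comment> \<open>Cancel \<open>r (p, q)\<close> in
      \<open>p (r, s) = (0, d) + r (p, q)\<close>.\<close>
    moreover have "C 0 d"
      using C_scale[OF C_nonneg(1)[OF C(2)] C(1)] C_scale[OF C_nonneg(1)[OF C(1)] C(2)]
        C_subtractive[of "r * p" "r * q" 0 d] d
      by (simp add: d_def mult.commute)
    ultimately have "C 1 0" "C 0 1"
      using C_scale[of "1 / d" d 0] C_scale[of "1 / d" 0 d] d by simp_all
    show ?thesis
    proof (intro bexI ballI)
      show "mat2 1 0 0 1 \<in> J"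
        using \<open>C 1 0\<close> \<open>C 0 1\<close> by (simp add: J_iff)
      show "A \<otimes>\<^bsub>nonneg_mat2\<^esub> mat2 1 0 0 1 = A" for A
        by (cases A rule: mat2_cases) (simp add: mult_eq mat2_mult)
    qed
  next
    case False
    have proportional: "p * s = q * r" if "C p q" "C r s" for p q r s
    proof -
      have "\<not> q * r < p * s" "\<not> s * p < r * q"
        using that False by blast+
      then show ?thesis by (simp add: mult.commute)
    qed
    consider "\<And>p q. C p q \<Longrightarrow> p = 0 \<and> q = 0" | p q where "C p q" "p > 0" | q where "C 0 q" "q > 0"
      using C_nonneg by (metis order_le_less)
    then show ?thesis
    proof cases
      case 1
      show ?thesis
      proof (intro bexI ballI)
        show "A \<otimes>\<^bsub>nonneg_mat2\<^esub> mat2 0 0 0 0 = A" if "A \<in> J" for A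
          using that 1 by (cases A rule: mat2_cases) (auto simp: mult_eq mat2_mult mat2_eq_iff J_iff)
      qed (simp add: J_iff C_zero)
    next
      case (2 p q)
      show ?thesis
      proof (intro bexI ballI)
        show "mat2 1 (q / p) 0 0 \<in> J"
          using C_scale[of "1 / p" p q] 2 by (simp add: J_iff C_zero)
        \<comment> \<open>A row \<open>(r, s)\<close> of \<open>A\<close> becomes
          \<open>(r, r q / p)\<close>, and \<open>p s = q r\<close> makes this \<open>(r, s)\<close>
          again.\<close>
        show "A \<otimes>\<^bsub>nonneg_mat2\<^esub> mat2 1 (q / p) 0 0 = A" if "A \<in> J" for A
          using that 2 proportional[of p q]
          by (cases A rule: mat2_cases) (auto simp: mult_eq mat2_mult mat2_eq_iff J_iff field_simps)
      qed
    next
      case (3 q)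
      show ?thesis
      proof (intro bexI ballI)
        show "mat2 0 0 0 1 \<in> J"
          using C_scale[of "1 / q" 0 q] 3 by (simp add: J_iff C_zero)
        \<comment> \<open>Proportionality to \<open>(0, q)\<close> forces the first column of
          \<open>A\<close> to vanish, and the product keeps the second.\<close>
        show "A \<otimes>\<^bsub>nonneg_mat2\<^esub> mat2 0 0 0 1 = A" if "A \<in> J" for A
          using that 3 proportional[of 0 q]
          by (cases A rule: mat2_cases) (auto simp: mult_eq mat2_mult mat2_eq_iff J_iff)
      qed
    qed
  qed
qed

theorem lemma2p18:
  fixes I :: "(real^2^2, 'm) module"
  assumes "left_semimodule nonneg_mat2 I"
  shows "S_i_injective TYPE('l) nonneg_mat2 I"
  using assms subtractive_left_ideal_right_identity by (rule S_i_injective_if_right_identities)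

end
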